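(* Let $G$ be a partial cube. Then $${\rm fdim}(G) = {\rm idim}(G) + p(X(G)) - 1.$$
   Context: All graphs are finite. For a string $u$, $u^{(i)}$ denotes its $i$-th coordinate. The $d$-cube $Q_d$ has vertex set $\{0,1\}^d$, two vertices adjacent iff they differ in exactly one coordinate. A Fibonacci string of length $d$ is a binary string of length $d$ with no two consecutive $1$s; the Fibonacci cube $\Gamma_d$ is the subgraph of $Q_d$ induced by the Fibonacci strings of length $d$. A graph $G$ isometrically embeds into $H$ if there is an injective map $V(G)\to V(H)$ preserving shortest-path distances. A partial cube is a graph that isometrically embeds into some hypercube. ${\rm idim}(G)$ is the least $k$ such that $G$ isometrically embeds into $Q_k$, and ${\rm fdim}(G)$ is the least $f$ such that $G$ isometrically embeds into $\Gamma_f$ (each is $\infty$ if no such integer exists). Semicubes and $X(G)$: let $G$ be a partial cube, $k={\rm idim}(G)$, and fix an isometric embedding $\beta:V(G)\to V(Q_k)$ (every coordinate $\beta^{(i)}$ then takes both values $0,1$ on $V(G)$; the resulting family of semicubes does not depend on the choice of $\beta$, up to reindexing). For $(i,\chi)\in[k]\times\{0,1\}$ the semicube is $W_{(i,\chi)}=\{u\in V(G)\mid \beta^{(i)}(u)=\chi\}$, and $W_{(i,0)},W_{(i,1)}$ form a complementary pair. $X(G)$ is the graph whose nodes are the $2k$ semicubes $W_{(i,\chi)}$, where $W_{(i,\chi)}$ and $W_{(j,\chi')}$ are adjacent iff $i\neq j$ and $W_{(i,\chi)}\cap W_{(j,\chi')}=\emptyset$. A coordinating path is a path $P$ of $X(G)$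 (a single node counts as a path) containing at most one node of each complementary pair $\{W_{(i,0)},W_{(i,1)}\}$. A system of coordinating paths is a set $\mathcal P$ of coordinating paths such that for each $i\in[k]$ there is exactly one $P\in\mathcal P$ containing a node of $\{W_{(i,0)},W_{(i,1)}\}$. $p(X(G))$ denotes the minimum size of a system of coordinating paths of $X(G)$. *)

theory Defs
  imports "Graph_Theory.Graph_Theory" "HOL-Library.Extended_Nat"
begin

text \<open>
  Graphs are the finite simple graphs of the locale \<open>graph\<close>, i.e. finite symmetric digraphs
  without loops and parallel arcs. The graph distance is the library's shortest path weight for
  unit arc weights; it is infinite between different components.
\<close>

definition graph_dist :: "('a, 'b) pre_digraph \<Rightarrow> 'a \<Rightarrow> 'a \<Rightarrow> ereal" where
  "graph_dist G u v = wf_digraph.\<mu> G (\<lambda>_. 1) u v"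

definition isometric_embedding ::
  "('a, 'b) pre_digraph \<Rightarrow> ('c, 'd) pre_digraph \<Rightarrow> ('a \<Rightarrow> 'c) \<Rightarrow> bool" where
  "isometric_embedding G H \<beta> \<longleftrightarrow>
     \<beta> ` verts G \<subseteq> verts H \<and> inj_on \<beta> (verts G) \<and>
     (\<forall>u\<in>verts G. \<forall>v\<in>verts G. graph_dist H (\<beta> u) (\<beta> v) = graph_dist G u v)"

definition isometrically_embeds ::
  "('a, 'b) pre_digraph \<Rightarrow> ('c, 'd) pre_digraph \<Rightarrow> bool" where
  "isometrically_embeds G H \<longleftrightarrow> (\<exists>\<beta>. isometric_embedding G H \<beta>)"

text \<open>
  Binary strings are Boolean lists with \<open>True\<close> for 1 and \<open>False\<close> for 0; coordinates are
  numbered from 0.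
\<close>

definition hypercube :: "nat \<Rightarrow> (bool list, bool list \<times> bool list) pre_digraph" where
  "hypercube d = with_proj \<lparr>
     pverts = {u. length u = d},
     parcs = {(u, v). length u = d \<and> length v = d \<and> (\<exists>!i. i < d \<and> u ! i \<noteq> v ! i)}\<rparr>"

lemma graph_hypercube: "graph (hypercube d)"
proof -
  define V where "V = {u :: bool list. length u = d}"
  define E where
    "E = {(u, v). length u = d \<and> length v = d \<and> (\<exists>!i. i < d \<and> u ! i \<noteq> (v :: bool list) ! i)}"
  have finV: "finite V"
    using finite_lists_length_eq[of "UNIV :: bool set" d] by (simp add: V_def)
  have E_sub: "E \<subseteq> V \<times> V"
    by (auto simp: E_def V_def)
  have sym: "sym E"
    unfolding E_def sym_def mem_Collect_eq case_prod_conv by metis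
  have no_loop: "(u, u) \<notin> E" for u
    by (auto simp: E_def)
  have "pair_graph \<lparr>pverts = V, parcs = E\<rparr>"
    by unfold_locales
      (use finV E_sub sym no_loop in
        \<open>auto simp: symmetric_def arcs_ends_conv intro: finite_subset[OF E_sub]\<close>)
  then show ?thesis
    unfolding hypercube_def V_def E_def by (rule pair_graph.pair_graphD_graph)
qed

definition fibonacci_string :: "bool list \<Rightarrow> bool" where
  "fibonacci_string u \<longleftrightarrow> (\<forall>i. Suc i < length u \<longrightarrow> \<not> (u ! i \<and> u ! Suc i))"

definition fibonacci_cube :: "nat \<Rightarrow> (bool list, bool list \<times> bool list) pre_digraph" where
  "fibonacci_cube d = hypercube d \<restriction> {u. length u = d \<and> fibonacci_string u}"

lemma graph_fibonacci_cube: "graph (fibonacci_cube d)"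
proof -
  interpret Q: graph "hypercube d" by (rule graph_hypercube)
  have sub: "{u. length u = d \<and> fibonacci_string u} \<subseteq> verts (hypercube d)"
    by (auto simp: hypercube_def)
  have "induced_subgraph (fibonacci_cube d) (hypercube d)"
    unfolding fibonacci_cube_def using sub by (rule Q.induced_induce)
  moreover have "digraph (fibonacci_cube d)"
    unfolding fibonacci_cube_def using sub by (rule Q.digraphI_induced[OF Q.induced_induce])
  ultimately show ?thesis
    using induced_graph_imp_symmetric[OF Q.sym_arcs] by (auto intro: digraph.graphI)
qed

definition partial_cube :: "('a, 'b) pre_digraph \<Rightarrow> bool" where
  "partial_cube G \<longleftrightarrow> graph G \<and> (\<exists>d. isometrically_embeds G (hypercube d))"

text \<open>The infimum of a nonempty set in \<^typ>\<open>enat\<close> is its least element; \<open>Inf {} = \<infinity>\<close>.\<close>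

definition idim :: "('a, 'b) pre_digraph \<Rightarrow> enat" where
  "idim G = Inf {enat k | k. isometrically_embeds G (hypercube k)}"

definition fdim :: "('a, 'b) pre_digraph \<Rightarrow> enat" where
  "fdim G = Inf {enat f | f. isometrically_embeds G (fibonacci_cube f)}"

definition semicube :: "('a, 'b) pre_digraph \<Rightarrow> ('a \<Rightarrow> bool list) \<Rightarrow> nat \<times> bool \<Rightarrow> 'a set" where
  "semicube G \<beta> = (\<lambda>(i, \<chi>). {u \<in> verts G. \<beta> u ! i = \<chi>})"

text \<open>
  The graph \<open>X(G)\<close> for an isometric embedding \<open>\<beta>\<close> of \<open>G\<close> into the \<open>k\<close>-cube. A node, i.e. a
  semicube, is represented by its index \<open>(i, \<chi>)\<close>.
\<close>

definition semicube_graph ::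
  "('a, 'b) pre_digraph \<Rightarrow> nat \<Rightarrow> ('a \<Rightarrow> bool list) \<Rightarrow>
     (nat \<times> bool, (nat \<times> bool) \<times> (nat \<times> bool)) pre_digraph" where
  "semicube_graph G k \<beta> = with_proj \<lparr>
     pverts = {..<k} \<times> UNIV,
     parcs = {(x, y). x \<in> {..<k} \<times> UNIV \<and> y \<in> {..<k} \<times> UNIV \<and> fst x \<noteq> fst y \<and>
                semicube G \<beta> x \<inter> semicube G \<beta> y = {}}\<rparr>"

lemma graph_semicube_graph: "graph (semicube_graph G k \<beta>)"
proof -
  have "finite {(x, y). x \<in> {..<k} \<times> (UNIV :: bool set) \<and> y \<in> {..<k} \<times> (UNIV :: bool set) \<and>
          fst x \<noteq> fst y \<and> semicube G \<beta> x \<inter> semicube G \<beta> y = {}}"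
    by (rule finite_subset[of _ "({..<k} \<times> UNIV) \<times> ({..<k} \<times> UNIV)"]) auto
  then show ?thesis
    unfolding semicube_graph_def
    by (intro pair_graph.pair_graphD_graph, unfold_locales) (auto simp: symmetric_def arcs_ends_def arc_to_ends_def sym_def)
qed

text \<open>
  A path is given by its nonempty list of distinct nodes. A nontrivial path has two such lists, but
  a system of coordinating paths cannot contain both.
\<close>

definition coordinating_path :: "(nat \<times> bool, 'e) pre_digraph \<Rightarrow> (nat \<times> bool) list \<Rightarrow> bool" where
  "coordinating_path X P \<longleftrightarrow>
     vpath P X \<and> (\<forall>i. \<not> ((i, False) \<in> set P \<and> (i, True) \<in> set P))"

definition coordinating_system ::
  "nat \<Rightarrow> (nat \<times> bool, 'e) pre_digraph \<Rightarrow> (nat \<times> bool) list set \<Rightarrow> bool" where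
  "coordinating_system k X \<P> \<longleftrightarrow>
     finite \<P> \<and> (\<forall>P\<in>\<P>. coordinating_path X P) \<and>
     (\<forall>i<k. \<exists>!P. P \<in> \<P> \<and> ((i, False) \<in> set P \<or> (i, True) \<in> set P))"

text \<open>
  With at most one vertex, \<open>k = 0\<close> and the only system is empty, so this number is 0. In that case,
  and only then, subtracting 1 from \<open>idim G + p(X(G))\<close> in \<^typ>\<open>enat\<close> is truncated.
\<close>

definition min_coordinating_system :: "nat \<Rightarrow> (nat \<times> bool, 'e) pre_digraph \<Rightarrow> nat" where
  "min_coordinating_system k X = (LEAST n. \<exists>\<P>. coordinating_system k X \<P> \<and> card \<P> = n)"

end

theory Submission
  imports Defs
begin

text \<open>
  Fibonacci cubes are isometric in hypercubes, so an embedding into \<open>\<Gamma>\<^sub>f\<close> is also one into \<open>Q\<^sub>f\<close>.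
  The coordinate flipped along an edge cuts the graph into the two halves of vertices nearer to one
  of its ends, hence the non-constant coordinates of any two hypercube embeddings agree up to order
  and complementation. An embedding into \<open>\<Gamma>\<^sub>f\<close> is therefore a word of length \<open>f\<close> that contains one
  semicube of every complementary pair, and some gaps (constant coordinates); being Fibonacci says
  that semicubes at consecutive positions are disjoint. The maximal gap-free blocks of such a word
  form a system of coordinating paths. Conversely, the paths of a system, separated by single gaps,
  form such a word; \<open>p\<close> paths need \<open>p - 1\<close> gaps.
\<close>

section \<open>Hamming distance\<close>

definition diff_set :: "bool list \<Rightarrow> bool list \<Rightarrow> nat set" where
  "diff_set u v = {i. i < length u \<and> u ! i \<noteq> v ! i}"

definition hamming :: "bool list \<Rightarrow> bool list \<Rightarrow> nat" where
  "hamming u v = card (diff_set u v)"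

lemma finite_diff_set [simp]: "finite (diff_set u v)"
  by (simp add: diff_set_def)

lemma hamming_same [simp]: "hamming u u = 0"
  by (simp add: hamming_def diff_set_def)

lemma hamming_eq_0_iff: "length u = length v \<Longrightarrow> hamming u v = 0 \<longleftrightarrow> u = v"
  by (auto simp: hamming_def diff_set_def list_eq_iff_nth_eq)

lemma hamming_commute: "length u = length v \<Longrightarrow> hamming u v = hamming v u"
  unfolding hamming_def diff_set_def by (rule arg_cong[where f = card]) auto

lemma hamming_eq_1_iff: "hamming u v = 1 \<longleftrightarrow> (\<exists>!i. i < length u \<and> u ! i \<noteq> v ! i)"
  by (simp add: hamming_def diff_set_def card_1_singleton_iff set_eq_iff Ex1_def) blast

lemma hamming_triangle:
  assumes "length u = length v"
  shows "hamming u w \<le> hamming u v + hamming v w"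
proof -
  have "diff_set u w \<subseteq> diff_set u v \<union> diff_set v w"
    using assms by (auto simp: diff_set_def)
  then have "card (diff_set u w) \<le> card (diff_set u v \<union> diff_set v w)"
    by (intro card_mono) auto
  then show ?thesis
    unfolding hamming_def using card_Un_le[of "diff_set u v" "diff_set v w"] by linarith
qed

lemma hamming_flip:
  assumes "i < length u" "u ! i \<noteq> v ! i"
  shows "hamming u (u[i := v ! i]) = 1" "hamming u v = Suc (hamming (u[i := v ! i]) v)"
proof -
  have "diff_set u (u[i := v ! i]) = {i}"
    using assms by (auto simp: diff_set_def nth_list_update)
  then show "hamming u (u[i := v ! i]) = 1"
    by (simp add: hamming_def)
  have "diff_set u v = insert i (diff_set (u[i := v ! i]) v)" "i \<notin> diff_set (u[i := v ! i]) v"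
    using assms by (auto simp: diff_set_def nth_list_update split: if_splits)
  then show "hamming u v = Suc (hamming (u[i := v ! i]) v)"
    by (simp add: hamming_def)
qed

lemma hamming_eq_1_unique:
  assumes "hamming u v = 1" "i < length u" "u ! i \<noteq> v ! i" "j < length u" "u ! j \<noteq> v ! j"
  shows "i = j"
  using assms unfolding hamming_eq_1_iff by blast

text \<open>The halves cut out by the coordinate in which \<open>u\<close> and \<open>v\<close> differ depend on the metric
  only.\<close>

lemma hamming_less_iff:
  assumes "hamming u v = 1" "i < length u" "u ! i \<noteq> v ! i" "length v = length u" "length w = length u"
  shows "hamming w u < hamming w v \<longleftrightarrow> w ! i = u ! i"
proof -
  have eq: "v ! j = u ! j" if "j < length u" "j \<noteq> i" for j
    using hamming_eq_1_unique[OF assms(1-3)] that by metis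
  show ?thesis
  proof (cases "w ! i = u ! i")
    case True
    have "diff_set w v = insert i (diff_set w u)" "i \<notin> diff_set w u"
      using assms eq True by (auto simp: diff_set_def)
    then show ?thesis
      using True by (simp add: hamming_def)
  next
    case False
    \<comment> \<open>Bits are Boolean, so \<open>w ! i = v ! i\<close>; elsewhere \<open>u\<close>
      and \<open>v\<close> agree.\<close>
    then have "diff_set w v \<subseteq> diff_set w u"
      using assms eq by (auto simp: diff_set_def)
    then show ?thesis
      using False by (auto simp: hamming_def not_less intro: card_mono)
  qed
qed

section \<open>Distances in cubes\<close>

text \<open>Between vertices of a set closed under replacing 1s by 0s, first clear the superfluous 1s of
  one end, then set the missing ones: this geodesic stays inside the set.\<close>

lemma graph_dist_induced_hypercube:
  assumes S: "\<And>u. u \<in> S \<Longrightarrow> length u = d"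
    and down: "\<And>u i. u \<in> S \<Longrightarrow> i < d \<Longrightarrow> u[i := False] \<in> S"
    and u: "u \<in> S" and v: "v \<in> S"
  shows "graph_dist (hypercube d \<restriction> S) u v = ereal (real (hamming u v))"
proof -
  let ?H = "hypercube d \<restriction> S"
  interpret Q: graph "hypercube d" by (rule graph_hypercube)
  interpret H: wf_digraph ?H by (rule Q.wellformed_induce_subgraph)
  have [simp]: "tail (hypercube d) = fst" "head (hypercube d) = snd"
    by (simp_all add: hypercube_def)
  have arcs: "(a, b) \<in> arcs ?H \<longleftrightarrow> a \<in> S \<and> b \<in> S \<and> hamming a b = 1" for a b
    using S unfolding hamming_eq_1_iff by (auto simp: hypercube_def)
  have cost: "H.awalk_cost (\<lambda>_. 1) p = real (length p)" for p
    by (induction p) auto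
  have lower: "hamming a b \<le> length p" if "H.awalk a p b" for a p b
    using that
  proof (induction p arbitrary: a)
    case Nil
    then show ?case
      using S by (auto simp: H.awalk_Nil_iff hamming_eq_0_iff)
  next
    case (Cons e p)
    obtain c where e: "e = (a, c)" "(a, c) \<in> arcs ?H" and p: "H.awalk c p b"
      using Cons.prems by (cases e) (auto simp: H.awalk_Cons_iff)
    then have "a \<in> S" "c \<in> S" "hamming a c = 1"
      using arcs by auto
    then show ?case
      using hamming_triangle[of a c b] Cons.IH[OF p] S by simp
  qed
  \<comment> \<open>At a differing coordinate exactly one end has a 1, and clearing it keeps that
    end in \<open>S\<close>. If it is \<open>a\<close>, \<open>w\<close> follows \<open>a\<close> on
    the geodesic; if it is \<open>b\<close>, \<open>w\<close> precedes \<open>b\<close>. Hence the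
    two alternatives, and an arc added in front or at the back below.\<close>
  have step: "\<exists>w\<in>S. hamming a w = 1 \<and> hamming a b = Suc (hamming w b) \<or>
                     hamming w b = 1 \<and> hamming a b = Suc (hamming a w)"
    if ab: "a \<in> S" "b \<in> S" "a \<noteq> b" for a b
  proof -
    obtain i where i: "i < d" "a ! i \<noteq> b ! i"
      using ab S nth_equalityI[of a b] by auto
    show ?thesis
    proof (cases "b ! i")
      case False
      then show ?thesis
        using hamming_flip[of i a b] down[of a i] i ab S by force
    next
      case True
      then show ?thesis
        using hamming_flip[of i b a] down[of b i] i ab S hamming_commute
        by (intro bexI[of _ "b[i := False]"]) (auto simp: hamming_commute)
    qed
  qed
  have upper: "\<exists>p. H.awalk a p b \<and> length p = hamming a b" if "a \<in> S" "b \<in> S" for a b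
    using that
  proof (induction "hamming a b" arbitrary: a b)
    case 0
    then show ?case
      using S by (intro exI[of _ "[]"]) (auto simp: H.awalk_Nil_iff hamming_eq_0_iff)
  next
    case (Suc n)
    then have "a \<noteq> b"
      using S hamming_eq_0_iff[of a b] by auto
    from step[OF Suc.prems this] consider
        w where "w \<in> S" "hamming a w = 1" "hamming a b = Suc (hamming w b)"
      | w where "w \<in> S" "hamming w b = 1" "hamming a b = Suc (hamming a w)"
      by blast
    then show ?case
    proof cases
      case 1
      then obtain p where "H.awalk w p b" "length p = n"
        using Suc by force
      moreover have "(a, w) \<in> arcs ?H"
        using 1 Suc arcs by blast
      ultimately have "H.awalk a ((a, w) # p) b" "length ((a, w) # p) = hamming a b"
        using Suc by (simp_all add: H.awalk_Cons_iff)
      then show ?thesis by blast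
    next
      case 2
      then obtain p where "H.awalk a p w" "length p = n"
        using Suc by force
      moreover have "(w, b) \<in> arcs ?H"
        using 2 Suc arcs by blast
      then have "H.awalk w [(w, b)] b"
        by (simp add: H.awalk_Cons_iff H.awalk_Nil_iff)
      ultimately have "H.awalk a (p @ [(w, b)]) b" "length (p @ [(w, b)]) = hamming a b"
        using Suc by (auto intro: H.awalk_appendI)
      then show ?thesis by blast
    qed
  qed
  have "(INF p\<in>{p. H.awalk u p v}. ereal (H.awalk_cost (\<lambda>_. 1) p)) = ereal (real (hamming u v))"
    using upper[OF u v] lower unfolding cost
    by (intro antisym INF_greatest) (auto intro: INF_lower2)
  then show ?thesis
    by (simp add: graph_dist_def H.\<mu>_def)
qed

text \<open>Clearing a 1 never creates two consecutive 1s, so the Fibonacci strings form a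
  down-set.\<close>

lemma graph_dist_fibonacci_cube:
  assumes "u \<in> verts (fibonacci_cube d)" "v \<in> verts (fibonacci_cube d)"
  shows "graph_dist (fibonacci_cube d) u v = ereal (real (hamming u v))"
  unfolding fibonacci_cube_def
proof (rule graph_dist_induced_hypercube)
  show "u[i := False] \<in> {u. length u = d \<and> fibonacci_string u}"
    if "u \<in> {u. length u = d \<and> fibonacci_string u}" "i < d" for u i
    using that by (auto simp: fibonacci_string_def nth_list_update)
qed (use assms in \<open>auto simp: fibonacci_cube_def\<close>)

lemma verts_hypercube: "u \<in> verts (hypercube d) \<longleftrightarrow> length u = d"
  by (simp add: hypercube_def)

lemma graph_dist_hypercube:
  assumes "length u = d" "length v = d"
  shows "graph_dist (hypercube d) u v = ereal (real (hamming u v))"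
proof -
  have "hypercube d \<restriction> {u. length u = d} = hypercube d"
    by (auto simp: induce_subgraph_def hypercube_def with_proj_def)
  then show ?thesis
    using graph_dist_induced_hypercube[of "{u. length u = d}" d u v] assms by simp
qed

lemma verts_fibonacci_cube: "u \<in> verts (fibonacci_cube d) \<longleftrightarrow> length u = d \<and> fibonacci_string u"
  by (simp add: fibonacci_cube_def)

lemma isometric_embedding_hypercube_iff:
  "isometric_embedding G (hypercube d) \<beta> \<longleftrightarrow>
     (\<forall>u\<in>verts G. length (\<beta> u) = d) \<and> inj_on \<beta> (verts G) \<and>
     (\<forall>u\<in>verts G. \<forall>v\<in>verts G. graph_dist G u v = ereal (real (hamming (\<beta> u) (\<beta> v))))"
proof -
  have "\<beta> ` verts G \<subseteq> verts (hypercube d) \<longleftrightarrow> (\<forall>u\<in>verts G. length (\<beta> u) = d)"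
    by (auto simp: verts_hypercube)
  moreover have "graph_dist (hypercube d) (\<beta> u) (\<beta> v) = graph_dist G u v \<longleftrightarrow>
      graph_dist G u v = ereal (real (hamming (\<beta> u) (\<beta> v)))"
    if "\<forall>u\<in>verts G. length (\<beta> u) = d" "u \<in> verts G" "v \<in> verts G" for u v
    using that graph_dist_hypercube[of "\<beta> u" d "\<beta> v"] by auto
  ultimately show ?thesis
    unfolding isometric_embedding_def by (smt (verit, ccfv_SIG))
qed

text \<open>Both cubes measure distance by Hamming distance, so only the range of the map
  matters.\<close>

lemma isometric_embedding_fibonacci_cube_iff:
  "isometric_embedding G (fibonacci_cube d) \<beta> \<longleftrightarrow>
     isometric_embedding G (hypercube d) \<beta> \<and> (\<forall>u\<in>verts G. fibonacci_string (\<beta> u))"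
proof -
  have "\<beta> ` verts G \<subseteq> verts (fibonacci_cube d) \<longleftrightarrow>
      \<beta> ` verts G \<subseteq> verts (hypercube d) \<and> (\<forall>u\<in>verts G. fibonacci_string (\<beta> u))"
    by (auto simp: verts_hypercube verts_fibonacci_cube)
  moreover have "graph_dist (fibonacci_cube d) (\<beta> u) (\<beta> v) = graph_dist (hypercube d) (\<beta> u) (\<beta> v)"
    if "\<beta> ` verts G \<subseteq> verts (fibonacci_cube d)" "u \<in> verts G" "v \<in> verts G" for u v
  proof -
    have "\<beta> u \<in> verts (fibonacci_cube d)" "\<beta> v \<in> verts (fibonacci_cube d)"
      using that by auto
    then show ?thesis
      using graph_dist_fibonacci_cube[of "\<beta> u" d "\<beta> v"] graph_dist_hypercube[of "\<beta> u" d "\<beta> v"]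
      by (simp add: verts_fibonacci_cube)
  qed
  ultimately show ?thesis
    unfolding isometric_embedding_def by (smt (verit, ccfv_SIG))
qed

section \<open>Gapped sequences of semicubes\<close>

definition somes :: "'a option list \<Rightarrow> 'a list" where
  "somes L = map the (filter (\<lambda>x. x \<noteq> None) L)"

lemma somes_simps [simp]:
  "somes [] = []" "somes (None # L) = somes L" "somes (Some x # L) = x # somes L"
  "somes (L @ L') = somes L @ somes L'"
  by (simp_all add: somes_def)

lemma somes_map_Some [simp]: "somes (map Some xs) = xs"
  by (induction xs) auto

text \<open>An entry \<open>Some (i, \<chi>)\<close> of \<open>L\<close> stands for a coordinate whose 1-semicube is \<open>semicube G \<beta> (i, \<chi>)\<close>, and
  \<open>None\<close> for a coordinate that is constantly 0.\<close>

definition recode :: "(nat \<times> bool) option list \<Rightarrow> bool list \<Rightarrow> bool list" where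
  "recode L w = map (\<lambda>x. case x of None \<Rightarrow> False | Some (i, \<chi>) \<Rightarrow> w ! i = \<chi>) L"

lemma length_recode [simp]: "length (recode L w) = length L"
  by (simp add: recode_def)

text \<open>Permuting and complementing coordinates preserves Hamming distance, and gaps add
  nothing. \<open>L\<close> uses each coordinate at most once and omits none in which
  \<open>u\<close> and \<open>v\<close> differ.\<close>

lemma hamming_recode:
  assumes "distinct (map fst (somes L))" "fst ` set (somes L) \<subseteq> {..<length u}"
    and "diff_set u v \<subseteq> fst ` set (somes L)"
  shows "hamming (recode L u) (recode L v) = hamming u v"
proof -
  let ?f = "\<lambda>w x. case x of None \<Rightarrow> False | Some (i, \<chi>) \<Rightarrow> w ! i = (\<chi> :: bool)"
  have "hamming (recode L u) (recode L v) = length (filter (\<lambda>x. ?f u x \<noteq> ?f v x) L)"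
    unfolding length_filter_conv_card hamming_def diff_set_def
    by (rule arg_cong[where f = card]) (auto simp: recode_def)
  \<comment> \<open>A gap never differs, and an entry \<open>Some (i, \<chi>)\<close> differs iff
    bit \<open>i\<close> does, whatever \<chi> is.\<close>
  also have "\<dots> = length (filter (\<lambda>i. u ! i \<noteq> v ! i) (map fst (somes L)))"
    by (induction L rule: list.induct) (auto simp: somes_def split: option.splits)
  also have "\<dots> = card (set (filter (\<lambda>i. u ! i \<noteq> v ! i) (map fst (somes L))))"
    using assms(1) by (metis distinct_card distinct_filter)
  also have "set (filter (\<lambda>i. u ! i \<noteq> v ! i) (map fst (somes L))) = diff_set u v"
    using assms(2,3) by (auto simp: diff_set_def)
  finally show ?thesis
    by (simp add: hamming_def)
qed

text \<open>Serves twice: with \<open>L\<close> using every coordinate, to build Fibonacci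
  embeddings, and with one constant coordinate deleted, to exploit the minimality of
  \<open>idim\<close>.\<close>

lemma isometric_embedding_recode:
  assumes \<beta>: "isometric_embedding G (hypercube k) \<beta>"
    and "distinct (map fst (somes L))" "fst ` set (somes L) \<subseteq> {..<k}"
    and "\<And>i u v. i < k \<Longrightarrow> u \<in> verts G \<Longrightarrow> v \<in> verts G \<Longrightarrow> \<beta> u ! i \<noteq> \<beta> v ! i \<Longrightarrow>
      i \<in> fst ` set (somes L)"
  shows "isometric_embedding G (hypercube (length L)) (\<lambda>u. recode L (\<beta> u))"
proof -
  have len: "length (\<beta> u) = k" if "u \<in> verts G" for u
    using \<beta> that by (simp add: isometric_embedding_hypercube_iff)
  have ham: "hamming (recode L (\<beta> u)) (recode L (\<beta> v)) = hamming (\<beta> u) (\<beta> v)"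
    if "u \<in> verts G" "v \<in> verts G" for u v
    by (rule hamming_recode) (use assms that len in \<open>auto simp: diff_set_def\<close>)
  have "inj_on (\<lambda>u. recode L (\<beta> u)) (verts G)"
  proof (rule inj_onI)
    fix u v assume uv: "u \<in> verts G" "v \<in> verts G" "recode L (\<beta> u) = recode L (\<beta> v)"
    then have "hamming (\<beta> u) (\<beta> v) = 0"
      using ham[of u v] by simp
    then have "\<beta> u = \<beta> v"
      using uv len by (simp add: hamming_eq_0_iff)
    then show "u = v"
      using \<beta> uv by (auto simp: isometric_embedding_def dest: inj_onD)
  qed
  then show ?thesis
    using \<beta> ham by (simp add: isometric_embedding_hypercube_iff)
qed

section \<open>Joining and splitting words at gaps\<close>

fun join_gaps :: "'a list list \<Rightarrow> 'a option list" where
  "join_gaps [] = []"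
| "join_gaps [P] = map Some P"
| "join_gaps (P # Q # Ps) = map Some P @ None # join_gaps (Q # Ps)"

lemma somes_join_gaps [simp]: "somes (join_gaps Ps) = concat Ps"
  by (induction Ps rule: join_gaps.induct) auto

text \<open>Gaps occur only between blocks, which is the source of the -1 in the formula. For
  \<open>Ps = []\<close> the subtraction truncates to 0, the correct length.\<close>

lemma length_join_gaps: "length (join_gaps Ps) = length (concat Ps) + length Ps - 1"
  by (induction Ps rule: join_gaps.induct) auto

text \<open>A gap is related to everything: next to a constant 0 the Fibonacci condition is
  void.\<close>

definition lift_rel :: "('a \<Rightarrow> 'a \<Rightarrow> bool) \<Rightarrow> 'a option \<Rightarrow> 'a option \<Rightarrow> bool" where
  "lift_rel R x y \<longleftrightarrow> (\<forall>a b. x = Some a \<longrightarrow> y = Some b \<longrightarrow> R a b)"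

lemma lift_rel_simps [simp]:
  "lift_rel R None y" "lift_rel R x None" "lift_rel R (Some a) (Some b) \<longleftrightarrow> R a b"
  by (simp_all add: lift_rel_def)

lemma successively_join_gaps:
  assumes "\<And>P. P \<in> set Ps \<Longrightarrow> successively R P"
  shows "successively (lift_rel R) (join_gaps Ps)"
  using assms
  by (induction Ps rule: join_gaps.induct)
     (auto simp: successively_append_iff successively_map successively_Cons)

text \<open>The blocks are the maximal gap-free stretches. Leading, trailing or repeated gaps only
  lengthen \<open>L\<close>, hence an inequality. The last conjunct strengthens the induction: an
  entry put in front of another entry must extend the first block.\<close>

lemma split_gaps:
  assumes "successively (lift_rel R) L"
  shows "\<exists>Ps. concat Ps = somes L \<and> [] \<notin> set Ps \<and> (\<forall>P\<in>set Ps. successively R P) \<and>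
    length (somes L) + length Ps \<le> Suc (length L) \<and>
    (\<forall>x L'. L = Some x # L' \<longrightarrow> (\<exists>P Ps'. Ps = (x # P) # Ps'))"
  using assms
proof (induction L rule: induct_list012)
  case 1
  show ?case by (rule exI[of _ "[]"]) simp
next
  case (2 x)
  show ?case
    by (rule exI[of _ "case x of None \<Rightarrow> [] | Some a \<Rightarrow> [[a]]"]) (cases x; simp)
next
  case (3 x y L)
  then obtain Ps where Ps: "concat Ps = somes (y # L)" "[] \<notin> set Ps" "\<forall>P\<in>set Ps. successively R P"
      "length (somes (y # L)) + length Ps \<le> Suc (length (y # L))"
      "\<And>a L'. y # L = Some a # L' \<Longrightarrow> \<exists>P Ps'. Ps = (a # P) # Ps'"
    by auto
  show ?case
  proof (cases x)
    case None
    then show ?thesis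
      using Ps(1-4) by (intro exI[of _ Ps]) auto
  next
    case x: (Some a)
    show ?thesis
    proof (cases y)
      case None
      \<comment> \<open>The gap pays for the new block \<open>[a]\<close>, so the hypothesis for
        \<open>L\<close> is needed; the one for \<open>y # L\<close> would give a bound weaker by
        one.\<close>
      obtain Qs where "concat Qs = somes L" "[] \<notin> set Qs" "\<forall>P\<in>set Qs. successively R P"
          "length (somes L) + length Qs \<le> Suc (length L)"
        using 3 by (auto simp: successively_Cons)
      then show ?thesis
        using x None by (intro exI[of _ "[a] # Qs"]) auto
    next
      case (Some b)
      then obtain P Ps' where "Ps = (b # P) # Ps'"
        using Ps(5) by blast
      then show ?thesis
        using x Some Ps(1-4) 3(3) by (intro exI[of _ "(a # b # P) # Ps'"]) auto
    qed
  qed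
qed

section \<open>Fibonacci strings and coordinating paths as conditions on neighbours\<close>

lemma successively_conv_nth:
  "successively R xs \<longleftrightarrow> (\<forall>i<length xs - 1. R (xs ! i) (xs ! Suc i))"
  by (induction R xs rule: successively.induct) (auto simp: All_less_Suc2)

lemma fibonacci_string_iff: "fibonacci_string u \<longleftrightarrow> successively (\<lambda>a b. \<not> (a \<and> b)) u"
  unfolding fibonacci_string_def successively_conv_nth by (simp add: less_diff_conv)

text \<open>Two consecutive 1s would place \<open>u\<close> in two disjoint semicubes.\<close>

lemma fibonacci_string_recode:
  assumes "successively (lift_rel R) L" "u \<in> verts G"
    and "\<And>x y. R x y \<Longrightarrow> semicube G \<beta> x \<inter> semicube G \<beta> y = {}"
  shows "fibonacci_string (recode L (\<beta> u))"
  unfolding fibonacci_string_iff recode_def successively_map using assms(1)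
proof (rule successively_mono)
  fix x y assume "lift_rel R x y"
  then show "\<not> ((case x of None \<Rightarrow> False | Some (i, \<chi>) \<Rightarrow> \<beta> u ! i = \<chi>) \<and>
                (case y of None \<Rightarrow> False | Some (i, \<chi>) \<Rightarrow> \<beta> u ! i = \<chi>))"
    using assms(2) assms(3)[of "the x" "the y"]
    by (auto simp: semicube_def split: option.splits)
qed

lemma set_vwalk_arcs_subset_iff:
  "set (vwalk_arcs P) \<subseteq> A \<longleftrightarrow> successively (\<lambda>x y. (x, y) \<in> A) P"
  by (induction P rule: vwalk_arcs.induct) auto

text \<open>Avoiding complementary pairs means that \<open>fst\<close> is injective on the nodes;
  with distinct nodes this is \<open>distinct (map fst P)\<close>.\<close>

lemma coordinating_path_iff:
  "coordinating_path X P \<longleftrightarrow> P \<noteq> [] \<and> set P \<subseteq> verts X \<and>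
     successively (\<lambda>x y. (x, y) \<in> arcs_ends X) P \<and> distinct (map fst P)"
proof -
  have "inj_on fst (set P) \<longleftrightarrow> (\<forall>i. \<not> ((i, False) \<in> set P \<and> (i, True) \<in> set P))"
    by (simp add: inj_on_def Ball_def all_bool_eq) blast
  then show ?thesis
    unfolding coordinating_path_def vpath_def vwalk_def set_vwalk_arcs_subset_iff
    by (auto simp: distinct_map)
qed

section \<open>Coordinates of an isometric embedding\<close>

text \<open>A function with different values at \<open>u\<close> and \<open>v\<close> changes along
  some arc of a walk between them, and arcs have Hamming length 1.\<close>

lemma ex_flipping_edge:
  assumes "graph G" and \<beta>: "isometric_embedding G (hypercube k) \<beta>"
    and uv: "u \<in> verts G" "v \<in> verts G" "P u \<noteq> P v"
  obtains x y where "x \<in> verts G" "y \<in> verts G" "P x \<noteq> P y" "hamming (\<beta> x) (\<beta> y) = 1"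
proof -
  interpret graph G by fact
  have dist: "graph_dist G x y = ereal (real (hamming (\<beta> x) (\<beta> y)))"
    if "x \<in> verts G" "y \<in> verts G" for x y
    using \<beta> that by (simp add: isometric_embedding_hypercube_iff)
  have edge: "hamming (\<beta> x) (\<beta> y) = 1" if xy: "x \<rightarrow>\<^bsub>G\<^esub> y" for x y
  proof -
    obtain e where e: "e \<in> arcs G" "tail G e = x" "head G e = y"
      using xy by (auto simp: arcs_ends_conv)
    then have V: "x \<in> verts G" "y \<in> verts G" and "x \<noteq> y"
      using no_loops by auto
    have "awalk x [e] y"
      using e V by (simp add: awalk_Cons_iff awalk_Nil_iff)
    then have "graph_dist G x y \<le> 1"
      using min_cost_le_walk_cost[of x "[e]" y "\<lambda>_. 1"] by (simp add: graph_dist_def one_ereal_def)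
    then have "hamming (\<beta> x) (\<beta> y) \<le> 1"
      using dist[OF V] by simp
    moreover have "hamming (\<beta> x) (\<beta> y) \<noteq> 0"
      using \<beta> V \<open>x \<noteq> y\<close> by (auto simp: isometric_embedding_hypercube_iff hamming_eq_0_iff dest: inj_onD)
    ultimately show ?thesis by simp
  qed
  \<comment> \<open>Unreachable vertices have infinite distance, but embedded ones have finite
    distance.\<close>
  have "u \<rightarrow>\<^sup>*\<^bsub>G\<^esub> v"
    using shortest_path_inf[of u v "\<lambda>_. 1"] dist[OF uv(1,2)] by (auto simp: graph_dist_def)
  then have "P u \<noteq> P v \<longrightarrow> (\<exists>x y. x \<rightarrow>\<^bsub>G\<^esub> y \<and> P x \<noteq> P y)"
  proof (induction rule: reachable_induct)
    case base
    then show ?case by simp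
  next
    case (step x y)
    then show ?case by (cases "P u = P x") auto
  qed
  then obtain x y where xy: "x \<rightarrow>\<^bsub>G\<^esub> y" "P x \<noteq> P y"
    using uv by blast
  show thesis
    by (rule that[of x y]) (use xy edge in \<open>auto intro: adj_in_verts\<close>)
qed

text \<open>Deleting a constant coordinate would embed \<open>G\<close> into a cube of dimension
  \<open>k - 1\<close>. In \<open>L\<close> each entry \<open>(j, True)\<close> copies bit
  \<open>j\<close> unchanged.\<close>

lemma idim_coordinate_not_constant:
  assumes "idim G = enat k" and \<beta>: "isometric_embedding G (hypercube k) \<beta>" and i: "i < k"
  shows "\<exists>u\<in>verts G. \<exists>v\<in>verts G. \<beta> u ! i \<noteq> \<beta> v ! i"
proof (rule ccontr)
  assume const: "\<not> ?thesis"
  define L where "L = map Some (map (\<lambda>j. (j, True)) (remove1 i [0..<k]))"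
  have somes: "somes L = map (\<lambda>j. (j, True)) (remove1 i [0..<k])"
    unfolding L_def by (rule somes_map_Some)
  have fst: "map fst (somes L) = remove1 i [0..<k]"
    by (simp add: somes comp_def)
  have set_fst: "fst ` set (somes L) = {..<k} - {i}"
    unfolding set_map[symmetric] fst by auto
  have "isometric_embedding G (hypercube (length L)) (\<lambda>u. recode L (\<beta> u))"
    by (rule isometric_embedding_recode[OF \<beta>]) (use const set_fst in \<open>auto simp: fst\<close>)
  moreover have "length L = k - 1"
    using i by (simp add: L_def length_remove1)
  ultimately have "idim G \<le> enat (k - 1)"
    unfolding idim_def by (intro Inf_lower) (auto simp: isometrically_embeds_def)
  then show False
    using assms by simp
qed

text \<open>On an edge \<open>x\<close>, \<open>y\<close> flipping coordinate \<open>j\<close> of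
  \<alpha>, \<beta> also flips exactly one coordinate \<open>i\<close>. Both coordinates separate
  the vertices nearer to \<open>x\<close> from the rest, so they agree up to complement.\<close>

lemma coordinate_eq_semicube:
  assumes "graph G" and \<alpha>: "isometric_embedding G (hypercube f) \<alpha>"
    and \<beta>: "isometric_embedding G (hypercube k) \<beta>"
    and "j < f" "u \<in> verts G" "v \<in> verts G" "\<alpha> u ! j \<noteq> \<alpha> v ! j"
  shows "\<exists>x. fst x < k \<and> {w \<in> verts G. \<alpha> w ! j} = semicube G \<beta> x"
proof -
  have len: "length (\<alpha> w) = f" "length (\<beta> w) = k" if "w \<in> verts G" for w
    using \<alpha> \<beta> that by (auto simp: isometric_embedding_hypercube_iff)
  have ham: "hamming (\<alpha> w) (\<alpha> w') = hamming (\<beta> w) (\<beta> w')" if "w \<in> verts G" "w' \<in> verts G" for w w'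
    using \<alpha> \<beta> that by (auto simp: isometric_embedding_hypercube_iff)
  obtain x y where xy: "x \<in> verts G" "y \<in> verts G" "\<alpha> x ! j \<noteq> \<alpha> y ! j" "hamming (\<alpha> x) (\<alpha> y) = 1"
    using ex_flipping_edge[OF assms(1) \<alpha> assms(5,6), of "\<lambda>w. \<alpha> w ! j"] assms(7) by blast
  then have "hamming (\<beta> x) (\<beta> y) = 1"
    using ham by simp
  then obtain i where i: "i < k" "\<beta> x ! i \<noteq> \<beta> y ! i"
    using len(2)[OF xy(1)] unfolding hamming_eq_1_iff by blast
  have "\<alpha> w ! j = \<alpha> x ! j \<longleftrightarrow> \<beta> w ! i = \<beta> x ! i" if w: "w \<in> verts G" for w
    using hamming_less_iff[of "\<alpha> x" "\<alpha> y" j "\<alpha> w"] hamming_less_iff[of "\<beta> x" "\<beta> y" i "\<beta> w"]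
      xy i ham len w assms(4) by simp
  \<comment> \<open>The bit is \<open>\<beta> x ! i\<close> if \<open>x\<close> itself lies in the
    1-half of \<open>j\<close>, and its negation otherwise.\<close>
  then have "{w \<in> verts G. \<alpha> w ! j} = semicube G \<beta> (i, \<beta> x ! i = \<alpha> x ! j)"
    unfolding semicube_def by auto
  then show ?thesis
    using i by (intro exI[of _ "(i, \<beta> x ! i = \<alpha> x ! j)"]) simp
qed

section \<open>Coordinating systems and the two inequalities\<close>

lemma semicube_graph_simps:
  "verts (semicube_graph G k \<beta>) = {..<k} \<times> UNIV"
  "(x, y) \<in> arcs_ends (semicube_graph G k \<beta>) \<longleftrightarrow>
     fst x < k \<and> fst y < k \<and> fst x \<noteq> fst y \<and> semicube G \<beta> x \<inter> semicube G \<beta> y = {}"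
  by (auto simp: semicube_graph_def mem_Times_iff)

text \<open>One-node paths form a system, so the \<open>LEAST\<close> in
  \<open>min_coordinating_system\<close> is attained.\<close>

lemma coordinating_system_exists: "\<exists>\<P>. coordinating_system k (semicube_graph G k \<beta>) \<P>"
proof
  show "coordinating_system k (semicube_graph G k \<beta>) ((\<lambda>i. [(i, False)]) ` {..<k})"
    unfolding coordinating_system_def
    by (auto simp: coordinating_path_iff semicube_graph_simps)
qed

lemma fdim_le_coordinating_system:
  assumes \<beta>: "isometric_embedding G (hypercube k) \<beta>"
    and sys: "coordinating_system k (semicube_graph G k \<beta>) \<P>"
  shows "fdim G \<le> enat (k + card \<P> - 1)"
proof -
  let ?X = "semicube_graph G k \<beta>"
  obtain Ps where Ps: "set Ps = \<P>" "distinct Ps"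
    using sys finite_distinct_list[of \<P>] unfolding coordinating_system_def by blast
  have path: "coordinating_path ?X P" if "P \<in> set Ps" for P
    using sys that Ps by (auto simp: coordinating_system_def)
  have cover: "\<exists>!P. P \<in> set Ps \<and> (\<exists>\<chi>. (i, \<chi>) \<in> set P)" if "i < k" for i
    using sys that Ps unfolding coordinating_system_def by (metis (full_types))
  have in_k: "fst x < k" if "P \<in> set Ps" "x \<in> set P" for x P
    using path[OF that(1)] that(2) by (auto simp: coordinating_path_iff semicube_graph_simps)
  \<comment> \<open>A coordinate determines its path because the system covers it once, and then its
    node because the path is coordinating.\<close>
  have eq: "x = y \<and> P = Q"
    if "P \<in> set Ps" "x \<in> set P" "Q \<in> set Ps" "y \<in> set Q" "fst x = fst y" for x y P Q
  proof -
    have "P = Q"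
      using cover[OF in_k[OF that(1,2)]] that by (metis prod.collapse)
    moreover have "inj_on fst (set P)"
      using path[OF that(1)] by (simp add: coordinating_path_iff distinct_map)
    ultimately show ?thesis
      using that by (auto dest: inj_onD)
  qed
  have dist: "distinct (map fst (concat Ps))"
    unfolding distinct_map
  proof
    show "distinct (concat Ps)"
      using Ps(2) path eq by (intro distinct_concat) (auto simp: coordinating_path_def vpath_def)
    show "inj_on fst (set (concat Ps))"
      using eq by (intro inj_onI) (metis UN_E set_concat)
  qed
  have set_fst: "fst ` set (concat Ps) = {..<k}"
  proof (intro equalityI subsetI)
    fix i assume "i \<in> {..<k}"
    then obtain P \<chi> where "P \<in> set Ps" "(i, \<chi>) \<in> set P"
      using cover[of i] by auto
    then show "i \<in> fst ` set (concat Ps)"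
      by force
  qed (use in_k in auto)
  define L where "L = join_gaps Ps"
  have "length (concat Ps) = k"
    using distinct_card[OF dist] set_fst by simp
  then have len: "length L = k + card \<P> - 1"
    using Ps by (simp add: L_def length_join_gaps distinct_card[symmetric])
  have "isometric_embedding G (hypercube (length L)) (\<lambda>u. recode L (\<beta> u))"
    by (rule isometric_embedding_recode[OF \<beta>]) (use dist set_fst in \<open>auto simp: L_def\<close>)
  moreover have "fibonacci_string (recode L (\<beta> u))" if "u \<in> verts G" for u
  proof (rule fibonacci_string_recode[OF _ that])
    show "successively (lift_rel (\<lambda>x y. (x, y) \<in> arcs_ends ?X)) L"
      unfolding L_def using path by (intro successively_join_gaps) (simp add: coordinating_path_iff)
  qed (simp add: semicube_graph_simps)
  ultimately have "isometrically_embeds G (fibonacci_cube (k + card \<P> - 1))"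
    unfolding isometrically_embeds_def isometric_embedding_fibonacci_cube_iff len by blast
  then show ?thesis
    unfolding fdim_def by (intro Inf_lower) auto
qed

text \<open>The map from \<open>j\<close> to \<open>fst (N j)\<close> is a bijection from the
  non-constant coordinates of \<alpha> onto those of \<beta>; the blocks of the resulting word are
  the paths.\<close>

lemma coordinating_system_of_fibonacci_embedding:
  assumes G: "graph G" and k: "idim G = enat k"
    and \<beta>: "isometric_embedding G (hypercube k) \<beta>"
    and \<alpha>: "isometric_embedding G (fibonacci_cube f) \<alpha>"
  shows "\<exists>\<P>. coordinating_system k (semicube_graph G k \<beta>) \<P> \<and> k + card \<P> \<le> Suc f"
proof -
  let ?X = "semicube_graph G k \<beta>"
  define V where "V = verts G"
  have \<alpha>': "isometric_embedding G (hypercube f) \<alpha>" and fib: "\<And>u. u \<in> V \<Longrightarrow> fibonacci_string (\<alpha> u)"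
    using \<alpha> by (auto simp: isometric_embedding_fibonacci_cube_iff V_def)
  have len: "length (\<alpha> w) = f" "length (\<beta> w) = k" if "w \<in> V" for w
    using \<alpha>' \<beta> that by (auto simp: isometric_embedding_hypercube_iff V_def)
  have ham: "hamming (\<alpha> w) (\<alpha> w') = hamming (\<beta> w) (\<beta> w')" if "w \<in> V" "w' \<in> V" for w w'
    using \<alpha>' \<beta> that by (auto simp: isometric_embedding_hypercube_iff V_def)
  define active where "active j \<longleftrightarrow> j < f \<and> (\<exists>u\<in>V. \<exists>v\<in>V. \<alpha> u ! j \<noteq> \<alpha> v ! j)" for j
  have "\<exists>x. fst x < k \<and> {w \<in> V. \<alpha> w ! j} = semicube G \<beta> x" if "active j" for j
    using that coordinate_eq_semicube[OF G \<alpha>' \<beta>] unfolding active_def V_def by blast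
  then obtain N where N: "\<And>j. active j \<Longrightarrow> fst (N j) < k \<and> {w \<in> V. \<alpha> w ! j} = semicube G \<beta> (N j)"
    by metis
  have flip: "\<alpha> x ! j \<noteq> \<alpha> y ! j \<longleftrightarrow> \<beta> x ! fst (N j) \<noteq> \<beta> y ! fst (N j)"
    if "active j" "x \<in> V" "y \<in> V" for j x y
  proof -
    have "\<alpha> w ! j \<longleftrightarrow> \<beta> w ! fst (N j) = snd (N j)" if "w \<in> V" for w
      using N[OF \<open>active j\<close>] that by (auto simp: semicube_def V_def split_beta)
    then show ?thesis
      using that by auto
  qed
  \<comment> \<open>An edge flipping \<open>j\<close> flips the common partner in \<beta>, hence
    also \<open>j'\<close>; but an edge flips only one coordinate.\<close>
  have inj: "j = j'" if j: "active j" "active j'" "fst (N j) = fst (N j')" for j j'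
  proof -
    obtain u v where "u \<in> V" "v \<in> V" "\<alpha> u ! j \<noteq> \<alpha> v ! j"
      using j by (auto simp: active_def)
    then obtain x y where xy: "x \<in> V" "y \<in> V" "\<alpha> x ! j \<noteq> \<alpha> y ! j" "hamming (\<alpha> x) (\<alpha> y) = 1"
      using ex_flipping_edge[OF G \<alpha>', of u v "\<lambda>w. \<alpha> w ! j"] unfolding V_def by blast
    then have "\<alpha> x ! j' \<noteq> \<alpha> y ! j'"
      using flip j by metis
    then show ?thesis
      using hamming_eq_1_unique[OF xy(4)] xy j len by (simp add: active_def)
  qed
  \<comment> \<open>By minimality of \<open>k\<close> some edge flips \<open>i\<close>. The
    coordinate \<open>j\<close> that \<alpha> flips there has its partner flipped too, and this can
    only be \<open>i\<close>.\<close>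
  have surj: "\<exists>j. active j \<and> fst (N j) = i" if i: "i < k" for i
  proof -
    obtain u v where "u \<in> V" "v \<in> V" "\<beta> u ! i \<noteq> \<beta> v ! i"
      using idim_coordinate_not_constant[OF k \<beta> i] by (auto simp: V_def)
    then obtain x y where xy: "x \<in> V" "y \<in> V" "\<beta> x ! i \<noteq> \<beta> y ! i" "hamming (\<beta> x) (\<beta> y) = 1"
      using ex_flipping_edge[OF G \<beta>, of u v "\<lambda>w. \<beta> w ! i"] unfolding V_def by blast
    then have "hamming (\<alpha> x) (\<alpha> y) = 1"
      using ham by simp
    then obtain j where j: "j < f" "\<alpha> x ! j \<noteq> \<alpha> y ! j"
      using len(1)[OF xy(1)] unfolding hamming_eq_1_iff by blast
    then have "active j"
      using xy by (auto simp: active_def)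
    then show ?thesis
      using flip[of j x y] hamming_eq_1_unique[OF xy(4), of i "fst (N j)"] xy i j len N by auto
  qed
  \<comment> \<open>A constant coordinate becomes a gap whichever value it has.\<close>
  define L where "L = map (\<lambda>j. if active j then Some (N j) else None) [0..<f]"
  have "somes (map (\<lambda>j. if active j then Some (N j) else None) js) = map N (filter active js)" for js
    by (induction js) auto
  then have somes: "somes L = map N (filter active [0..<f])"
    by (simp add: L_def)
  have dist: "distinct (map fst (somes L))"
    unfolding somes map_map by (auto simp: distinct_map inj_on_def intro: inj)
  have set_fst: "fst ` set (somes L) = {..<k}"
  proof -
    have "set (somes L) = N ` {j. active j}"
      unfolding somes by (auto simp: active_def)
    moreover have "fst ` N ` {j. active j} = {..<k}"
      using N surj by (auto simp: image_iff) metis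
    ultimately show ?thesis
      by simp
  qed
  have "successively (lift_rel (\<lambda>x y. (x, y) \<in> arcs_ends ?X)) L"
    unfolding successively_conv_nth
  proof (intro allI impI)
    fix j assume j: "j < length L - 1"
    have "(N j, N (Suc j)) \<in> arcs_ends ?X" if a: "active j" "active (Suc j)"
    proof -
      have "fst (N j) \<noteq> fst (N (Suc j))"
        using inj[OF a] by auto
      moreover have "{w \<in> V. \<alpha> w ! j} \<inter> {w \<in> V. \<alpha> w ! Suc j} = {}"
        using fib len a by (auto simp: fibonacci_string_def active_def)
      ultimately show ?thesis
        using N a by (simp add: semicube_graph_simps)
    qed
    then show "lift_rel (\<lambda>x y. (x, y) \<in> arcs_ends ?X) (L ! j) (L ! Suc j)"
      using j by (auto simp: L_def lift_rel_def split: if_splits)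
  qed
  then obtain Ps where Ps: "concat Ps = somes L" "[] \<notin> set Ps"
      "\<And>P. P \<in> set Ps \<Longrightarrow> successively (\<lambda>x y. (x, y) \<in> arcs_ends ?X) P"
      "length (somes L) + length Ps \<le> Suc (length L)"
    using split_gaps by metis
  have sub: "set P \<subseteq> set (somes L)" if "P \<in> set Ps" for P
    using that unfolding Ps(1)[symmetric] by auto
  \<comment> \<open>Since no coordinate repeats in the whole word, blocks share no nodes, contain no
    complementary pair, and cover each \<open>i\<close> only once.\<close>
  have inj_fst: "inj_on fst (set (somes L))" and "distinct (concat Ps)"
    using dist by (simp_all add: distinct_map Ps(1))
  then have eq: "P = Q" if "P \<in> set Ps" "Q \<in> set Ps" "x \<in> set P" "x \<in> set Q" for P Q x
    using that unfolding distinct_concat_iff by blast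
  have "coordinating_path ?X P" if P: "P \<in> set Ps" for P
    unfolding coordinating_path_iff
  proof (intro conjI)
    have "distinct P"
      using \<open>distinct (concat Ps)\<close> P by (simp add: distinct_concat_iff)
    then show "distinct (map fst P)"
      using inj_fst sub[OF P] by (auto simp: distinct_map intro: inj_on_subset)
    show "set P \<subseteq> verts ?X"
      using sub[OF P] set_fst by (force simp: semicube_graph_simps)
  qed (use P Ps in auto)
  moreover have "\<exists>!P. P \<in> set Ps \<and> ((i, False) \<in> set P \<or> (i, True) \<in> set P)" if i: "i < k" for i
  proof -
    have "i \<in> fst ` set (concat Ps)"
      using i set_fst Ps(1) by simp
    then obtain P \<chi> where P: "P \<in> set Ps" "(i, \<chi>) \<in> set P"
      by auto
    show ?thesis
    proof (rule ex1I[of _ P])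
      show "P \<in> set Ps \<and> ((i, False) \<in> set P \<or> (i, True) \<in> set P)"
        using P by (cases \<chi>) auto
      fix Q assume "Q \<in> set Ps \<and> ((i, False) \<in> set Q \<or> (i, True) \<in> set Q)"
      then obtain \<chi>' where Q: "Q \<in> set Ps" "(i, \<chi>') \<in> set Q"
        by auto
      then have "(i, \<chi>') = (i, \<chi>)"
        using inj_onD[OF inj_fst, of "(i, \<chi>')" "(i, \<chi>)"] P sub by auto
      then show "Q = P"
        using eq P Q by metis
    qed
  qed
  ultimately have "coordinating_system k ?X (set Ps)"
    by (simp add: coordinating_system_def)
  moreover have "length (somes L) = k"
    using distinct_card[OF dist] set_fst by simp
  then have "k + card (set Ps) \<le> Suc f"
    using Ps(4) card_length[of Ps] by (simp add: L_def)
  ultimately show ?thesis by blast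
qed

theorem theorem3p3:
  fixes G :: "('a, 'b) pre_digraph" and k :: nat and \<beta> :: "'a \<Rightarrow> bool list"
  assumes "partial_cube G"
    and "idim G = enat k"
    and "isometric_embedding G (hypercube k) \<beta>"
  shows "fdim G = idim G + enat (min_coordinating_system k (semicube_graph G k \<beta>)) - 1"
proof -
  let ?X = "semicube_graph G k \<beta>"
  define p where "p = min_coordinating_system k ?X"
  have G: "graph G"
    using assms(1) by (simp add: partial_cube_def)
  obtain \<P> where "coordinating_system k ?X \<P>" "card \<P> = p"
    using LeastI_ex[of "\<lambda>n. \<exists>\<P>. coordinating_system k ?X \<P> \<and> card \<P> = n"]
      coordinating_system_exists[of k G \<beta>]
    unfolding p_def min_coordinating_system_def by blast
  then have "fdim G \<le> enat (k + p - 1)"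
    using fdim_le_coordinating_system[OF assms(3)] by blast
  moreover have "enat (k + p - 1) \<le> fdim G"
    unfolding fdim_def
  proof (rule Inf_greatest)
    fix n assume "n \<in> {enat f | f. isometrically_embeds G (fibonacci_cube f)}"
    then obtain f \<alpha> where f: "n = enat f" "isometric_embedding G (fibonacci_cube f) \<alpha>"
      by (auto simp: isometrically_embeds_def)
    obtain \<Q> where \<Q>: "coordinating_system k ?X \<Q>" "k + card \<Q> \<le> Suc f"
      using coordinating_system_of_fibonacci_embedding[OF G assms(2,3) f(2)] by blast
    have "p \<le> card \<Q>"
      unfolding p_def min_coordinating_system_def by (rule Least_le) (use \<Q>(1) in blast)
    then show "enat (k + p - 1) \<le> n"
      using \<Q>(2) f(1) by simp
  qed
  \<comment> \<open>Subtraction in \<open>enat\<close> truncates as in \<open>nat\<close>, so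
    \<open>k = p = 0\<close> needs no separate case.\<close>
  ultimately show ?thesis
    unfolding p_def[symmetric] assms(2) by (simp add: one_enat_def)
qed

end
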